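(* For each $k \in \mathbb{N}$ there exists $\varepsilon = \varepsilon(k) > 0$ such that there are at most $2^{n^{2-\varepsilon}}$ distinct $U(k)$-free graphs on vertex set $[n]$.
   Context: For $k \in \mathbb{N}$, $U(k)$ is the bipartite graph with parts $A$, identified with the set of all subsets of $[k]$ (so $|A| = 2^k$), and $B = [k]$, in which $a \in A$ is adjacent to $b \in B$ iff $b \in a$. A graph $G$ is $U(k)$-free if there do not exist disjoint sets $A', B' \subset V(G)$ such that the bipartite graph $G[A',B']$ (the edges of $G$ between $A'$ and $B'$) is isomorphic to $U(k)$ with $A'$ corresponding to $A$ and $B'$ to $B$. Graphs on $[n]$ are labelled. *)

theory Defs
  imports Complex_Main "HOL-Library.Ramsey"
begin

text \<open>
  A bipartite graph with ordered parts \<open>A\<close>, \<open>B\<close> and edge set \<open>R \<subseteq> A \<times> B\<close> is a triple \<open>(A, B, R)\<close>.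
  The two parts may have different types, so no disjointness condition is needed here.
\<close>

type_synonym ('a, 'b) bigraph = "'a set \<times> 'b set \<times> ('a \<times> 'b) set"

text \<open>Isomorphism respecting the order of the parts: first part to first part, second to second.\<close>

definition bigraph_iso :: "('a, 'b) bigraph \<Rightarrow> ('c, 'd) bigraph \<Rightarrow> bool" where
  "bigraph_iso G H \<longleftrightarrow>
     (case (G, H) of ((A, B, R), (A', B', R')) \<Rightarrow>
        \<exists>f g. bij_betw f A A' \<and> bij_betw g B B' \<and>
              (\<forall>a\<in>A. \<forall>b\<in>B. (a, b) \<in> R \<longleftrightarrow> (f a, g b) \<in> R'))"

definition universal_bigraph :: "nat \<Rightarrow> (nat set, nat) bigraph" where
  "universal_bigraph k =
     (Pow {1..k}, {1..k}, {(a, b). a \<in> Pow {1..k} \<and> b \<in> {1..k} \<and> b \<in> a})"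

definition graphs_on :: "'v set \<Rightarrow> 'v set set set" where
  "graphs_on V = {E. E \<subseteq> nsets V 2}"

definition between_bigraph :: "'v set set \<Rightarrow> 'v set \<Rightarrow> 'v set \<Rightarrow> ('v, 'v) bigraph" where
  "between_bigraph E A B = (A, B, {(x, y). x \<in> A \<and> y \<in> B \<and> {x, y} \<in> E})"

definition U_free :: "nat \<Rightarrow> 'v set \<Rightarrow> 'v set set \<Rightarrow> bool" where
  "U_free k V E \<longleftrightarrow>
     \<not> (\<exists>A B. A \<subseteq> V \<and> B \<subseteq> V \<and> A \<inter> B = {} \<and>
              bigraph_iso (universal_bigraph k) (between_bigraph E A B))"

end

theory Submission
  imports Defs "HOL-Real_Asymp.Real_Asymp" "HOL-Library.FuncSet"
begin

text \<open>
  The neighbourhoods in a \<open>U(k)\<close>-free graph form a family of VC dimension at most \<open>2 * k\<close>. If members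
  of such a family pairwise differ in at least \<open>s\<close> of the \<open>n\<close> vertices, then greedily chosen
  \<open>m \<approx> (2 * n / s) * ln n\<close> vertices tell them all apart, so by Sauer--Shelah there are at most
  \<open>(m + 1) ^ (2 * k)\<close> of them. Hence every neighbourhood is one of these few centres up to \<open>s\<close>
  corrections, and taking \<open>s\<close> to be \<open>n\<close> to a power slightly below \<open>1\<close> leaves only
  \<open>n powr (2 - \<epsilon>)\<close> bits to describe the graph.
\<close>

section \<open>Shattering and the Sauer--Shelah lemma\<close>

definition shatters :: "'a set set \<Rightarrow> 'a set \<Rightarrow> bool" where
  "shatters F T \<longleftrightarrow> Pow T \<subseteq> (\<lambda>A. A \<inter> T) ` F"

lemma shattersI: "(\<And>Y. Y \<subseteq> T \<Longrightarrow> \<exists>A\<in>F. A \<inter> T = Y) \<Longrightarrow> shatters F T"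
  unfolding shatters_def by blast

lemma shattersD: "shatters F T \<Longrightarrow> Y \<subseteq> T \<Longrightarrow> \<exists>A\<in>F. A \<inter> T = Y"
  unfolding shatters_def by blast

lemma shatters_mono: "shatters F T \<Longrightarrow> F \<subseteq> G \<Longrightarrow> shatters G T"
  unfolding shatters_def by blast

text \<open>Pajor's form of Sauer--Shelah, by induction on the ground set. Deleting \<open>x\<close>
  merges pairs \<open>A\<close>, \<open>insert x A\<close> of \<open>F\<close>, and
  \<open>F1\<close> counts the merged pairs. Sets shattered by \<open>F0\<close> avoid
  \<open>x\<close>, while those shattered by \<open>F1\<close> stay shattered by \<open>F\<close>
  after adding \<open>x\<close>, so nothing is counted twice.\<close>

lemma card_le_card_shattered:
  assumes "finite S" "F \<subseteq> Pow S"
  shows "card F \<le> card {T. T \<subseteq> S \<and> shatters F T}"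
  using assms
proof (induction S arbitrary: F rule: finite_induct)
  case empty
  have "{T. T \<subseteq> {} \<and> shatters F T} = (if F = {} then {} else {{}})"
    by (auto simp: shatters_def)
  moreover have "F = {} \<or> F = {{}}"
    using empty by auto
  ultimately show ?case by auto
next
  case (insert x S)
  define F0 where "F0 = (\<lambda>A. A - {x}) ` F"
  define F1 where "F1 = {A \<in> F. x \<notin> A \<and> insert x A \<in> F}"
  \<comment> \<open>From each merged pair \<open>H\<close> keeps the member containing
    \<open>x\<close>, so deletion of \<open>x\<close> is a bijection from \<open>H\<close> onto
    \<open>F0\<close>.\<close>
  define H where "H = {A \<in> F. x \<notin> A \<longrightarrow> insert x A \<notin> F}"
  have fin: "finite F"
    using insert by (meson finite.insertI finite_Pow_iff finite_subset)
  have sub0: "F0 \<subseteq> Pow S" and sub1: "F1 \<subseteq> Pow S"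
    using insert.prems by (auto simp: F0_def F1_def)
  have "inj_on (\<lambda>A. A - {x}) H"
  proof (rule inj_onI)
    fix A B assume *: "A \<in> H" "B \<in> H" "A - {x} = B - {x}"
    then have "x \<in> A \<longleftrightarrow> x \<in> B"
      unfolding H_def by (metis (lifting) Diff_empty Diff_insert0 insert_Diff mem_Collect_eq)
    with * show "A = B" by blast
  qed
  moreover have "(\<lambda>A. A - {x}) ` H = F0"
  proof
    show "F0 \<subseteq> (\<lambda>A. A - {x}) ` H"
    proof
      fix B assume "B \<in> F0"
      then obtain A where A: "A \<in> F" "B = A - {x}" by (auto simp: F0_def)
      show "B \<in> (\<lambda>A. A - {x}) ` H"
      proof (cases "A \<in> H")
        case False
        then have "insert x A \<in> H" "B = insert x A - {x}" using A by (auto simp: H_def)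
        then show ?thesis by blast
      qed (use A in blast)
    qed
  qed (auto simp: H_def F0_def)
  ultimately have "card F0 = card H" by (metis card_image)
  moreover have "F = H \<union> F1" "H \<inter> F1 = {}"
    by (auto simp: H_def F1_def)
  ultimately have card_F: "card F = card F0 + card F1"
    using fin by (metis card_Un_disjoint finite_Un)
  let ?S0 = "{T. T \<subseteq> S \<and> shatters F0 T}" and ?S1 = "{T. T \<subseteq> S \<and> shatters F1 T}"
  have inj: "inj_on (insert x) ?S1"
    using insert.hyps by (auto simp: inj_on_def)
  have finS: "finite ?S0" "finite ?S1" using insert.hyps by auto
  have "card F \<le> card ?S0 + card (insert x ` ?S1)"
    using card_F insert.IH[OF sub0] insert.IH[OF sub1] card_image[OF inj] by simp
  also have "\<dots> = card (?S0 \<union> insert x ` ?S1)"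
    by (rule card_Un_disjoint[symmetric]) (use finS insert.hyps in auto)
  also have "\<dots> \<le> card {T. T \<subseteq> insert x S \<and> shatters F T}"
  proof (rule card_mono)
    show "finite {T. T \<subseteq> insert x S \<and> shatters F T}"
      using insert.hyps by auto
    have "shatters F T" if T: "T \<subseteq> S" "shatters F0 T" for T
    proof (rule shattersI)
      fix Y assume "Y \<subseteq> T"
      then obtain A where "A \<in> F" "(A - {x}) \<inter> T = Y"
        using shattersD[OF T(2)] unfolding F0_def by blast
      moreover have "x \<notin> T" using T insert.hyps by auto
      ultimately show "\<exists>A\<in>F. A \<inter> T = Y" by blast
    qed
    moreover have "shatters F (insert x T)" if T: "T \<subseteq> S" "shatters F1 T" for T
    proof (rule shattersI)
      fix Y assume Y: "Y \<subseteq> insert x T"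
      then have "Y - {x} \<subseteq> T" by auto
      from shattersD[OF T(2) this]
      obtain A where A: "A \<in> F" "x \<notin> A" "insert x A \<in> F" "A \<inter> T = Y - {x}"
        by (auto simp: F1_def)
      \<comment> \<open>Both \<open>A\<close> and \<open>insert x A\<close> lie in \<open>F\<close>;
        whether \<open>x\<close> is in \<open>Y\<close> decides which one serves.\<close>
      show "\<exists>A\<in>F. A \<inter> insert x T = Y"
      proof (cases "x \<in> Y")
        case True
        then have "insert x A \<inter> insert x T = Y" using A by blast
        with A show ?thesis by blast
      next
        case False
        then have "A \<inter> insert x T = Y" using A by blast
        with A show ?thesis by blast
      qed
    qed
    ultimately show "?S0 \<union> insert x ` ?S1 \<subseteq> {T. T \<subseteq> insert x S \<and> shatters F T}"
      by auto
  qed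
  finally show ?case .
qed

text \<open>Such a subset is listed as a word of length \<open>d\<close> over \<open>S\<close>,
  padded with \<open>None\<close>; the alphabet has \<open>card S + 1\<close> letters.\<close>

lemma card_small_subsets_le:
  assumes "finite S"
  shows "card {T. T \<subseteq> S \<and> card T \<le> d} \<le> (card S + 1) ^ d"
proof -
  let ?L = "{xs. set xs \<subseteq> insert None (Some ` S) \<and> length xs = d}"
  let ?f = "\<lambda>xs. {x. Some x \<in> set xs}"
  have finL: "finite ?L"
    using assms by (intro finite_lists_length_eq) auto
  have "{T. T \<subseteq> S \<and> card T \<le> d} \<subseteq> ?f ` ?L"
  proof
    fix T assume "T \<in> {T. T \<subseteq> S \<and> card T \<le> d}"
    then have T: "T \<subseteq> S" "card T \<le> d" by auto
    obtain ys where ys: "set ys = T" "distinct ys"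
      using finite_distinct_list[OF finite_subset[OF T(1) assms]] by auto
    define xs where "xs = map Some ys @ replicate (d - card T) None"
    have "length xs = d"
      using T ys distinct_card[of ys] by (simp add: xs_def)
    moreover have "set xs \<subseteq> insert None (Some ` S)" "T = ?f xs"
      using T ys by (auto simp: xs_def)
    ultimately show "T \<in> ?f ` ?L" by blast
  qed
  then have "card {T. T \<subseteq> S \<and> card T \<le> d} \<le> card (?f ` ?L)"
    using finL by (intro card_mono) auto
  also have "\<dots> \<le> card ?L" using finL by (rule card_image_le)
  also have "\<dots> = card (insert None (Some ` S)) ^ d"
    using assms by (intro card_lists_length_eq) auto
  also have "card (insert None (Some ` S)) = card S + 1"
    using assms by (subst card_insert_disjoint) (auto simp: card_image)
  finally show ?thesis .
qed

lemma sauer_shelah_weak: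
  assumes "finite S" "F \<subseteq> Pow S" and vc: "\<And>T. T \<subseteq> S \<Longrightarrow> shatters F T \<Longrightarrow> card T \<le> d"
  shows "card F \<le> (card S + 1) ^ d"
proof -
  have "card F \<le> card {T. T \<subseteq> S \<and> shatters F T}"
    using assms by (intro card_le_card_shattered)
  also have "\<dots> \<le> card {T. T \<subseteq> S \<and> card T \<le> d}"
    using assms by (intro card_mono) auto
  also have "\<dots> \<le> (card S + 1) ^ d"
    using assms by (intro card_small_subsets_le)
  finally show ?thesis .
qed

section \<open>Greedy separation and the packing bound\<close>

text \<open>Empty exactly when intersecting with \<open>S\<close> is injective on \<open>F\<close>.
  Pairs are ordered, so \<open>card F ^ 2\<close> bounds their number.\<close>

definition unseparated :: "'a set set \<Rightarrow> 'a set \<Rightarrow> ('a set \<times> 'a set) set" where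
  "unseparated F S = {(A, B). A \<in> F \<and> B \<in> F \<and> A \<noteq> B \<and> A \<inter> S = B \<inter> S}"

text \<open>Averaging: every unseparated pair is split by at least \<open>s\<close> of the
  \<open>card X\<close> points, so some point splits at least the fraction \<open>s / card X\<close>
  of the pairs.\<close>

lemma greedy_separation_step:
  assumes X: "finite X" "X \<noteq> {}" and F: "finite F" "F \<subseteq> Pow X"
    and sep: "\<And>A B. A \<in> F \<Longrightarrow> B \<in> F \<Longrightarrow> A \<noteq> B \<Longrightarrow> s \<le> card (sym_diff A B)"
  shows "\<exists>x\<in>X. real (card (unseparated F (insert x S)))
           \<le> (1 - real s / real (card X)) * real (card (unseparated F S))"
proof (rule ccontr)
  assume neg: "\<not> ?thesis"
  define P where "P = unseparated F S"
  define D where "D = (\<lambda>x. {p \<in> P. x \<in> sym_diff (fst p) (snd p)})"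
  have finP: "finite P"
    by (rule finite_subset[of _ "F \<times> F"]) (use F in \<open>auto simp: P_def unseparated_def\<close>)
  have finD: "finite (D x)" for x using finP by (auto simp: D_def)
  have cX: "real (card X) > 0" using X by (simp add: card_gt_0_iff)
  have D_less: "real (card (D x)) < real s / real (card X) * real (card P)" if "x \<in> X" for x
  proof -
    have "A \<inter> insert x S = B \<inter> insert x S \<longleftrightarrow> A \<inter> S = B \<inter> S \<and> x \<notin> sym_diff A B" for A B
      by blast
    then have "unseparated F (insert x S) = P - D x"
      unfolding P_def D_def unseparated_def by fastforce
    moreover have "card (P - D x) = card P - card (D x)" "card (D x) \<le> card P"
      using finP finD by (auto simp: card_Diff_subset D_def intro!: card_mono)
    ultimately have "real (card (unseparated F (insert x S))) = real (card P) - real (card (D x))"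
      by simp
    then show ?thesis using neg that by (force simp: P_def algebra_simps)
  qed
  \<comment> \<open>Double counting of pairs against the points splitting them: counted by pairs the
    total is at least \<open>s * card P\<close>, counted by points the negated claim keeps it
    strictly below.\<close>
  have "real s * real (card P) = (\<Sum>p\<in>P. real s)" by simp
  also have "\<dots> \<le> (\<Sum>p\<in>P. real (card {x \<in> X. x \<in> sym_diff (fst p) (snd p)}))"
  proof (rule sum_mono)
    fix p assume "p \<in> P"
    then have p: "fst p \<in> F" "snd p \<in> F" "fst p \<noteq> snd p"
      by (simp_all add: P_def unseparated_def case_prod_beta)
    then have "{x \<in> X. x \<in> sym_diff (fst p) (snd p)} = sym_diff (fst p) (snd p)"
      using F by blast
    then show "real s \<le> real (card {x \<in> X. x \<in> sym_diff (fst p) (snd p)})"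
      using sep[OF p] by simp
  qed
  also have "\<dots> = (\<Sum>x\<in>X. real (card (D x)))"
  proof -
    have "(\<Sum>p\<in>P. card {x \<in> X. x \<in> sym_diff (fst p) (snd p)}) =
          (\<Sum>x\<in>X. card {p \<in> P. x \<in> sym_diff (fst p) (snd p)})"
      using sum_multicount_gen[of P X "\<lambda>p x. x \<in> sym_diff (fst p) (snd p)"
          "\<lambda>x. card {p \<in> P. x \<in> sym_diff (fst p) (snd p)}"] finP X by simp
    then show ?thesis unfolding D_def of_nat_sum[symmetric] by (rule arg_cong)
  qed
  also have "\<dots> < (\<Sum>x\<in>X. real s / real (card X) * real (card P))"
    using X D_less by (intro sum_strict_mono) auto
  also have "\<dots> = real s * real (card P)" using cX by simp
  finally show False by simp
qed

lemma greedy_separation: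
  assumes X: "finite X" "X \<noteq> {}" and F: "finite F" "F \<subseteq> Pow X"
    and s: "s \<le> card X"
    and sep: "\<And>A B. A \<in> F \<Longrightarrow> B \<in> F \<Longrightarrow> A \<noteq> B \<Longrightarrow> s \<le> card (sym_diff A B)"
  shows "\<exists>S\<subseteq>X. card S \<le> m \<and> real (card (unseparated F S))
           \<le> (1 - real s / real (card X)) ^ m * real (card F) ^ 2"
proof (induction m)
  case 0
  have "card (unseparated F {}) \<le> card (F \<times> F)"
    using F by (intro card_mono) (auto simp: unseparated_def)
  then have "real (card (unseparated F {})) \<le> real (card F) ^ 2"
    by (simp add: card_cartesian_product power2_eq_square flip: of_nat_mult)
  then show ?case by (intro exI[of _ "{}"]) simp
next
  case (Suc m)
  then obtain S where S: "S \<subseteq> X" "card S \<le> m"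
    "real (card (unseparated F S)) \<le> (1 - real s / real (card X)) ^ m * real (card F) ^ 2"
    by blast
  obtain x where x: "x \<in> X" "real (card (unseparated F (insert x S)))
           \<le> (1 - real s / real (card X)) * real (card (unseparated F S))"
    using greedy_separation_step[OF X F sep] by blast
  have "0 \<le> 1 - real s / real (card X)"
    using s X by (simp add: card_gt_0_iff divide_le_eq)
  then have "real (card (unseparated F (insert x S)))
      \<le> (1 - real s / real (card X)) * ((1 - real s / real (card X)) ^ m * real (card F) ^ 2)"
    using x(2) S(3) by (meson mult_left_mono order_trans)
  moreover have "card (insert x S) \<le> Suc m"
    using S(2) card_insert_le_m1[of "Suc m" S x] by simp
  ultimately show ?case using S x by (intro exI[of _ "insert x S"]) (auto simp: mult.assoc)
qed

lemma shatters_trace: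
  assumes "shatters ((\<lambda>A. A \<inter> S) ` F) T" "T \<subseteq> S"
  shows "shatters F T"
proof (rule shattersI)
  fix Y assume "Y \<subseteq> T"
  from shattersD[OF assms(1) this] obtain A where "A \<in> F" "A \<inter> S \<inter> T = Y" by auto
  moreover have "A \<inter> S \<inter> T = A \<inter> T" using assms(2) by blast
  ultimately show "\<exists>A\<in>F. A \<inter> T = Y" by auto
qed

text \<open>At most \<open>m\<close> greedy points leave fewer than one unseparated pair, hence
  none. So \<open>F\<close> has as many members as traces on these points, and Sauer--Shelah bounds
  the traces.\<close>

lemma packing_bound:
  assumes X: "finite X" "X \<noteq> {}" and F: "F \<subseteq> Pow X" "card F \<le> card X"
    and sep: "\<And>A B. A \<in> F \<Longrightarrow> B \<in> F \<Longrightarrow> A \<noteq> B \<Longrightarrow> s \<le> card (sym_diff A B)"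
    and vc: "\<And>T. T \<subseteq> X \<Longrightarrow> shatters F T \<Longrightarrow> card T \<le> d"
    and sm: "2 * real (card X) * ln (real (card X)) < real s * real m"
  shows "card F \<le> (m + 1) ^ d"
proof -
  let ?n = "real (card X)"
  have n: "?n > 0" using X by (simp add: card_gt_0_iff)
  have finF: "finite F" using F X by (meson finite_Pow_iff finite_subset)
  have trace: "card F \<le> (card S + 1) ^ d" if "S \<subseteq> X" "unseparated F S = {}" for S
  proof -
    have "inj_on (\<lambda>A. A \<inter> S) F"
      using that(2) by (auto simp: inj_on_def unseparated_def)
    then have "card F = card ((\<lambda>A. A \<inter> S) ` F)" by (simp add: card_image)
    also have "\<dots> \<le> (card S + 1) ^ d"
      using that X F vc
      by (intro sauer_shelah_weak) (auto intro: finite_subset dest: shatters_trace)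
    finally show ?thesis .
  qed
  show ?thesis
  proof (cases "card F \<le> 1")
    case True
    then show ?thesis by (meson le_add2 one_le_power order_trans)
  next
    case False
    \<comment> \<open>Two distinct members are needed to see \<open>s \<le> card X\<close>: their
      symmetric difference fits into \<open>X\<close>.\<close>
    then obtain A B where AB: "A \<in> F" "B \<in> F" "A \<noteq> B"
      using card_le_Suc0_iff_eq[OF finF] by auto
    have "sym_diff A B \<subseteq> X" using AB F by blast
    then have s: "s \<le> card X"
      using sep[OF AB] card_mono[OF X(1)] by (meson order_trans)
    obtain S where S: "S \<subseteq> X" "card S \<le> m"
      "real (card (unseparated F S)) \<le> (1 - real s / ?n) ^ m * real (card F) ^ 2"
      using greedy_separation[OF X finF F(1) s sep] by blast
    have "0 \<le> 1 - real s / ?n" using s n by simp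
    moreover have "1 - real s / ?n \<le> exp (- (real s / ?n))"
      using exp_ge_add_one_self[of "- (real s / ?n)"] by simp
    ultimately have "(1 - real s / ?n) ^ m \<le> exp (- (real s / ?n)) ^ m"
      by (intro power_mono)
    also have "\<dots> = exp (- (real s * real m / ?n))"
      by (simp add: exp_of_nat_mult[symmetric] mult.commute)
    \<comment> \<open>By \<open>sm\<close> the decay exponent exceeds \<open>2 * ln ?n\<close>; the
      factor then drops below \<open>1 / ?n ^ 2\<close> and beats the at most \<open>?n ^ 2\<close>
      initial pairs.\<close>
    also have "\<dots> < exp (- (2 * ln ?n))"
      using sm n by (simp add: less_divide_eq algebra_simps)
    also have "\<dots> = 1 / ?n ^ 2"
      using n by (simp add: exp_minus exp_double inverse_eq_divide)
    finally have "(1 - real s / ?n) ^ m * real (card F) ^ 2 < 1 / ?n ^ 2 * real (card F) ^ 2"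
      using False by (intro mult_strict_right_mono) auto
    also have "\<dots> \<le> 1 / ?n ^ 2 * ?n ^ 2"
      using F(2) by (intro mult_left_mono power_mono) auto
    also have "\<dots> = 1" using n by simp
    finally have "card (unseparated F S) = 0" using S(3) by linarith
    moreover have "finite (unseparated F S)"
      by (rule finite_subset[of _ "F \<times> F"]) (use finF in \<open>auto simp: unseparated_def\<close>)
    ultimately have "card F \<le> (card S + 1) ^ d" using S trace by simp
    also have "\<dots> \<le> (m + 1) ^ d" using S by (intro power_mono) auto
    finally show ?thesis .
  qed
qed

section \<open>Encoding maps by centres and corrections\<close>

text \<open>A maximal \<open>s\<close>-separated subfamily works: a member at distance more than
  \<open>s\<close> from all of it could be added.\<close>

lemma exists_maximal_packing:
  assumes "finite F"
  shows "\<exists>R\<subseteq>F. (\<forall>A\<in>R. \<forall>B\<in>R. A \<noteq> B \<longrightarrow> s \<le> card (sym_diff A B)) \<and>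
                (\<forall>A\<in>F. \<exists>B\<in>R. card (sym_diff B A) \<le> s)"
proof -
  define \<P> where "\<P> = {R. R \<subseteq> F \<and> (\<forall>A\<in>R. \<forall>B\<in>R. A \<noteq> B \<longrightarrow> s \<le> card (sym_diff A B))}"
  have "finite \<P>" "{} \<in> \<P>" using assms by (auto simp: \<P>_def)
  then obtain R where R: "R \<in> \<P>" "\<And>Q. Q \<in> \<P> \<Longrightarrow> R \<subseteq> Q \<Longrightarrow> R = Q"
    using finite_has_maximal[of \<P>] by blast
  have "\<exists>B\<in>R. card (sym_diff B A) \<le> s" if A: "A \<in> F" for A
  proof (rule ccontr)
    assume far: "\<not> ?thesis"
    then have "insert A R \<in> \<P>"
      using R(1) A by (auto simp: \<P>_def Un_commute not_le)
    then have "A \<in> R" using R(2)[of "insert A R"] by blast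
    with far show False by auto
  qed
  with R(1) show ?thesis by (auto simp: \<P>_def)
qed

text \<open>
  Every map \<open>N\<close> as below is encoded by a list of at most \<open>(m + 1) ^ d\<close> centres, an index into
  that list for each vertex, and for each vertex a set of at most \<open>s\<close> corrections.
\<close>

lemma card_bounded_vc_maps_le:
  fixes X :: "'a set"
  assumes X: "finite X" "X \<noteq> {}"
    and sm: "2 * real (card X) * ln (real (card X)) < real s * real m"
    and \<N>: "\<And>N. N \<in> \<N> \<Longrightarrow> N \<in> X \<rightarrow>\<^sub>E Pow X"
    and vc: "\<And>N T. N \<in> \<N> \<Longrightarrow> T \<subseteq> X \<Longrightarrow> shatters (N ` X) T \<Longrightarrow> card T \<le> d"
  defines "t \<equiv> (m + 1) ^ d"
  shows "card \<N> \<le> t ^ card X * (2 ^ card X) ^ t * ((card X + 1) ^ s) ^ card X"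
proof -
  let ?small = "{T. T \<subseteq> X \<and> card T \<le> s}"
  let ?C = "X \<rightarrow>\<^sub>E {..<t}" and ?M = "{..<t} \<rightarrow>\<^sub>E Pow X" and ?D = "X \<rightarrow>\<^sub>E ?small"
  \<comment> \<open>Decoding: symmetric difference is an involution, so the correction at
    \<open>v\<close> is the symmetric difference of its centre and \<open>N v\<close>.\<close>
  let ?f = "\<lambda>(c, M, D). \<lambda>v\<in>X. sym_diff (M (c v)) (D v)"
  have fin: "finite (?C \<times> ?M \<times> ?D)"
    using X by (intro finite_cartesian_product finite_PiE) auto
  have "\<N> \<subseteq> ?f ` (?C \<times> ?M \<times> ?D)"
  proof
    fix N assume N: "N \<in> \<N>"
    have NX: "N ` X \<subseteq> Pow X" using \<N>[OF N] by auto
    obtain R where R: "R \<subseteq> N ` X"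
      "\<forall>A\<in>R. \<forall>B\<in>R. A \<noteq> B \<longrightarrow> s \<le> card (sym_diff A B)"
      "\<forall>A\<in>N ` X. \<exists>B\<in>R. card (sym_diff B A) \<le> s"
      using exists_maximal_packing[OF finite_imageI[OF X(1)], of N s] by (elim exE conjE)
    have finR: "finite R" using R(1) X by (meson finite_imageI finite_subset)
    have "card R \<le> t" unfolding t_def
    proof (rule packing_bound[OF X _ _ R(2)[rule_format] _ sm])
      show "R \<subseteq> Pow X" using R NX by blast
      \<comment> \<open>The centres are values of \<open>N\<close>, so there are at most as many as
        vertices.\<close>
      show "card R \<le> card X" using R(1) X by (meson surj_card_le)
      show "card T \<le> d" if "T \<subseteq> X" "shatters R T" for T
        using vc[OF N] shatters_mono[OF _ R(1)] that by blast
    qed auto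
    moreover obtain h where h: "bij_betw h R {..<card R}"
      using finR ex_bij_betw_finite_nat atLeast0LessThan by metis
    ultimately have hR: "h ` R \<subseteq> {..<t}" by (auto simp: bij_betw_def)
    have "\<forall>v\<in>X. \<exists>B. B \<in> R \<and> card (sym_diff B (N v)) \<le> s"
      using R(3) unfolding ball_simps Bex_def .
    from bchoice[OF this]
    obtain r where r: "\<And>v. v \<in> X \<Longrightarrow> r v \<in> R \<and> card (sym_diff (r v) (N v)) \<le> s"
      by blast
    define c where "c = (\<lambda>v\<in>X. h (r v))"
    define M where "M = (\<lambda>i\<in>{..<t}. if i \<in> h ` R then inv_into R h i else {})"
    define D where "D = (\<lambda>v\<in>X. sym_diff (r v) (N v))"
    have injh: "inj_on h R" using h by (simp add: bij_betw_def)
    have RX: "B \<subseteq> X" if "B \<in> R" for B using R(1) NX that by blast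
    have "c \<in> ?C" using r hR by (auto simp: c_def)
    moreover have "M \<in> ?M"
    proof -
      have "(if i \<in> h ` R then inv_into R h i else {}) \<in> Pow X" for i
        using RX inv_into_into[of i h R] by simp
      then show ?thesis unfolding M_def by (intro restrict_PiE_iff[THEN iffD2] ballI)
    qed
    moreover have "D \<in> ?D"
    proof -
      have "sym_diff (r v) (N v) \<subseteq> X" if "v \<in> X" for v
        using RX[of "r v"] r[OF that] NX that by blast
      then show ?thesis using r by (simp add: D_def)
    qed
    moreover have "N = ?f (c, M, D)"
    proof
      fix v
      show "N v = ?f (c, M, D) v"
      proof (cases "v \<in> X")
        case True
        then have "M (c v) = r v"
          using r[OF True] hR injh by (auto simp: M_def c_def)
        with True show ?thesis by (auto simp: D_def)
      qed (use \<N>[OF N] in auto)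
    qed
    ultimately show "N \<in> ?f ` (?C \<times> ?M \<times> ?D)" by blast
  qed
  then have "card \<N> \<le> card (?C \<times> ?M \<times> ?D)"
    using fin by (rule surj_card_le[rotated])
  also have "\<dots> = t ^ card X * (2 ^ card X) ^ t * card ?small ^ card X"
    using X by (simp add: card_cartesian_product card_PiE card_Pow)
  also have "\<dots> \<le> t ^ card X * (2 ^ card X) ^ t * ((card X + 1) ^ s) ^ card X"
    using X by (intro mult_left_mono power_mono card_small_subsets_le) auto
  finally show ?thesis .
qed

section \<open>Neighbourhoods in \<open>U(k)\<close>-free graphs\<close>

text \<open>Restriction to \<open>V\<close> places the map in the extensional space
  \<open>V \<rightarrow>\<^sub>E Pow V\<close> that the encoding counts.\<close>

definition nbhd :: "'v set \<Rightarrow> 'v set set \<Rightarrow> 'v \<Rightarrow> 'v set" where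
  "nbhd V E = (\<lambda>v\<in>V. {w \<in> V. {v, w} \<in> E})"

lemma inj_on_nbhd: "inj_on (nbhd V) (graphs_on V)"
proof (rule inj_onI)
  have sub: "E \<subseteq> E'" if E: "E \<in> graphs_on V" "nbhd V E = nbhd V E'" for E E'
  proof
    fix e assume e: "e \<in> E"
    then have "e \<in> nsets V 2" using E by (auto simp: graphs_on_def)
    then obtain x y where xy: "e = {x, y}" "x \<in> V" "y \<in> V"
      by (auto simp: nsets_def card_2_iff)
    then have "y \<in> nbhd V E x" using e by (simp add: nbhd_def)
    then have "y \<in> nbhd V E' x" using E(2) by simp
    then show "e \<in> E'" using xy by (simp add: nbhd_def)
  qed
  fix E E' assume "E \<in> graphs_on V" "E' \<in> graphs_on V" "nbhd V E = nbhd V E'"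
  then show "E = E'" using sub[of E E'] sub[of E' E] by auto
qed

text \<open>
  Shattering \<open>2 * k\<close> vertices gives each trace on \<open>k\<close> of them at least \<open>2 ^ k > k\<close> times,
  so each trace is realised outside these \<open>k\<close> vertices.
\<close>

lemma U_free_imp_vc:
  assumes V: "finite V" and U: "U_free k V E" and T: "T \<subseteq> V" "shatters (nbhd V E ` V) T"
  shows "card T \<le> 2 * k"
proof (rule ccontr)
  assume "\<not> ?thesis"
  then have cT: "2 * k \<le> card T" by simp
  have finT: "finite T" using T V finite_subset by blast
  obtain B where B: "B \<subseteq> T" "card B = k" "finite B"
    using obtain_subset_with_card_n[of k T] cT by auto
  obtain g where g: "bij_betw g {1..k} B"
    using ex_bij_betw_nat_finite_1[OF B(3)] B(2) by auto
  have "\<exists>v. v \<in> V - B \<and> nbhd V E v \<inter> B = Y" if Y: "Y \<subseteq> B" for Y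
  proof (rule ccontr)
    assume none: "\<not> ?thesis"
    \<comment> \<open>A vertex with trace \<open>Y \<union> Z\<close> on \<open>T\<close> has trace
      \<open>Y\<close> on \<open>B\<close>, so by \<open>none\<close> it lies in \<open>B\<close>.
      Different \<open>Z\<close> need different vertices, which overfills \<open>B\<close>.\<close>
    have "\<forall>Z\<in>Pow (T - B). \<exists>v\<in>V. nbhd V E v \<inter> T = Y \<union> Z"
      using shattersD[OF T(2)] Y B(1) by (metis (no_types, lifting) Diff_subset PowD Un_least image_iff order_trans)
    then obtain w where w: "\<And>Z. Z \<in> Pow (T - B) \<Longrightarrow> w Z \<in> V \<and> nbhd V E (w Z) \<inter> T = Y \<union> Z"
      by metis
    have "w ` Pow (T - B) \<subseteq> B"
    proof
      fix v assume "v \<in> w ` Pow (T - B)"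
      then obtain Z where Z: "Z \<subseteq> T - B" "v = w Z" by auto
      have "nbhd V E v \<inter> B = (nbhd V E v \<inter> T) \<inter> B" using B by blast
      also have "\<dots> = Y" using w[of Z] Z Y by auto
      finally show "v \<in> B" using none w[of Z] Z by auto
    qed
    moreover have "inj_on w (Pow (T - B))"
    proof (rule inj_onI)
      fix Z Z' assume *: "Z \<in> Pow (T - B)" "Z' \<in> Pow (T - B)" "w Z = w Z'"
      then have "Y \<union> Z = Y \<union> Z'" using w by metis
      then show "Z = Z'" using * Y by blast
    qed
    ultimately have "card (Pow (T - B)) \<le> k"
      using B by (metis card_inj_on_le)
    moreover have "card (Pow (T - B)) = 2 ^ (card T - k)"
      using B finT by (simp add: card_Pow card_Diff_subset)
    moreover have "(2::nat) ^ k \<le> 2 ^ (card T - k)"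
      using cT by (intro power_increasing) auto
    ultimately show False using less_exp[of k] by simp
  qed
  \<comment> \<open>The vertex chosen for \<open>a\<close> plays the part of the set
    \<open>a\<close>, transported to \<open>B\<close> by \<open>g\<close>; lying outside
    \<open>B\<close> makes the two parts disjoint.\<close>
  then have "\<forall>a\<in>Pow {1..k}. \<exists>v. v \<in> V - B \<and> nbhd V E v \<inter> B = g ` a"
    using g by (metis PowD bij_betw_imp_surj_on image_mono)
  then obtain f where f: "\<And>a. a \<in> Pow {1..k} \<Longrightarrow> f a \<in> V - B \<and> nbhd V E (f a) \<inter> B = g ` a"
    by metis
  have injg: "inj_on g {1..k}" using g by (simp add: bij_betw_def)
  have "inj_on f (Pow {1..k})"
  proof (rule inj_onI)
    fix a b assume *: "a \<in> Pow {1..k}" "b \<in> Pow {1..k}" "f a = f b"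
    then have "g ` a = g ` b" using f by metis
    then show "a = b" using * injg by (simp add: inj_on_image_eq_iff)
  qed
  then have "bij_betw f (Pow {1..k}) (f ` Pow {1..k})" by (simp add: bij_betw_def)
  moreover have "b \<in> a \<longleftrightarrow> {f a, g b} \<in> E" if ab: "a \<in> Pow {1..k}" "b \<in> {1..k}" for a b
  proof -
    have gb: "g b \<in> B" using g ab by (auto simp: bij_betw_def)
    have "b \<in> a \<longleftrightarrow> g b \<in> g ` a"
      using ab injg by (metis PowD inj_on_image_mem_iff)
    also have "\<dots> \<longleftrightarrow> g b \<in> nbhd V E (f a)" using f[OF ab(1)] gb by blast
    also have "\<dots> \<longleftrightarrow> {f a, g b} \<in> E"
      using f[OF ab(1)] gb B T by (auto simp: nbhd_def)
    finally show ?thesis .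
  qed
  moreover have "g b \<in> B" if "b \<in> {1..k}" for b using g that by (auto simp: bij_betw_def)
  ultimately have "bigraph_iso (universal_bigraph k) (between_bigraph E (f ` Pow {1..k}) B)"
    using g unfolding bigraph_iso_def universal_bigraph_def between_bigraph_def
    by (auto intro!: exI[of _ f] exI[of _ g])
  moreover have "f ` Pow {1..k} \<subseteq> V" "f ` Pow {1..k} \<inter> B = {}" "B \<subseteq> V"
    using f B T by auto
  ultimately show False using U unfolding U_free_def by blast
qed

section \<open>Counting graphs and balancing the parameters\<close>

lemma card_U_free_le:
  fixes k m n s :: nat
  assumes n: "n > 0" and sm: "2 * real n * ln (real n) < real s * real m"
  defines "t \<equiv> (m + 1) ^ (2 * k)"
  shows "card {E \<in> graphs_on {1..n}. U_free k {1..n} E}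
         \<le> t ^ n * (2 ^ n) ^ t * ((n + 1) ^ s) ^ n"
proof -
  let ?G = "{E \<in> graphs_on {1..n}. U_free k {1..n} E}"
  have "card ?G = card (nbhd {1..n} ` ?G)"
    using inj_on_nbhd by (metis (no_types, lifting) card_image inj_on_subset mem_Collect_eq subsetI)
  also have "\<dots> \<le> t ^ card {1..n} * (2 ^ card {1..n}) ^ t * ((card {1..n} + 1) ^ s) ^ card {1..n}"
    unfolding t_def
  proof (rule card_bounded_vc_maps_le)
    fix N assume "N \<in> nbhd {1..n} ` ?G"
    then obtain E where E: "N = nbhd {1..n} E" "U_free k {1..n} E" by auto
    show "N \<in> {1..n} \<rightarrow>\<^sub>E Pow {1..n}" by (auto simp: E nbhd_def)
    show "card T \<le> 2 * k" if "T \<subseteq> {1..n}" "shatters (N ` {1..n}) T" for T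
      using U_free_imp_vc[OF _ E(2)] that by (simp add: E)
  qed (use n sm in auto)
  finally show ?thesis by simp
qed

text \<open>The trivial count of all graphs, meant for \<open>n = 0\<close> and for the
  \<open>n\<close> below the asymptotic threshold.\<close>

lemma card_graphs_le: "real (card {E \<in> graphs_on {1..n}. P E}) \<le> 2 powr (real n ^ 2 / 2)"
proof -
  have fin: "finite (nsets {1..n} 2)" by (simp add: finite_imp_finite_nsets)
  have "card {E \<in> graphs_on {1..n}. P E} \<le> card (Pow (nsets {1..n} 2))"
    using fin by (intro card_mono) (auto simp: graphs_on_def)
  also have "\<dots> = 2 ^ (n choose 2)" using fin by (simp add: card_Pow card_nsets)
  finally have "real (card {E \<in> graphs_on {1..n}. P E}) \<le> 2 powr real (n choose 2)"
    by (simp add: powr_realpow)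
  also have "\<dots> \<le> 2 powr (real n ^ 2 / 2)"
  proof (intro powr_mono)
    have "2 * (n choose 2) \<le> n ^ 2"
      by (simp add: choose_two power2_eq_square algebra_simps)
    then have "real (2 * (n choose 2)) \<le> real (n ^ 2)" by (rule of_nat_mono)
    then show "real (n choose 2) \<le> real n ^ 2 / 2" by simp
  qed simp
  finally show ?thesis .
qed

text \<open>With \<open>s\<close> near \<open>n powr (1 - \<beta>)\<close> and \<open>m\<close> near
  \<open>n powr (2 * \<beta>)\<close>, the product \<open>s * m\<close> beats
  \<open>2 * n * ln n\<close>. Corrections cost order \<open>n powr (2 - \<beta>) * log 2 n\<close>
  bits; \<open>\<beta>\<close> is small enough that \<open>t\<close> is of order at most
  \<open>n powr (1/2)\<close>. Conceding \<open>\<beta> / 2\<close> in the exponent absorbs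
  logarithm and constants.\<close>

lemma eventually_card_U_free_le:
  fixes k :: nat
  defines "\<beta> \<equiv> 1 / (8 * (real k + 1))"
  shows "eventually (\<lambda>n. real (card {E \<in> graphs_on {1..n}. U_free k {1..n} E})
                       \<le> 2 powr (real n powr (2 - \<beta> / 2))) sequentially"
proof -
  have \<beta>: "0 < \<beta>" "\<beta> < 1/2" "\<beta> * (4 * real k) \<le> 1 / 2"
    by (auto simp: \<beta>_def field_simps)
  \<comment> \<open>In turn: the condition on \<open>s * m\<close>, the bits for indices and
    centres, the bits for corrections. The last two get half the budget each.\<close>
  have "eventually (\<lambda>n. 2 * real n * ln (real n) < real n powr (1 + \<beta>)) sequentially"
    using \<beta> by real_asymp
  moreover have "eventually (\<lambda>n. 2 * real n * (9 ^ k * real n powr (1/2))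
      \<le> real n powr (2 - \<beta> / 2) / 2) sequentially"
    using \<beta> by real_asymp
  moreover have "eventually (\<lambda>n. (2 * real n powr (1 - \<beta>)) * real n * log 2 (real n + 1)
      \<le> real n powr (2 - \<beta> / 2) / 2) sequentially"
    using \<beta> by real_asymp
  ultimately show ?thesis
    using eventually_gt_at_top[of 0]
  proof eventually_elim
    case (elim n)
    define m where "m = nat \<lceil>real n powr (2 * \<beta>)\<rceil>"
    define s where "s = nat \<lceil>real n powr (1 - \<beta>)\<rceil>"
    define t where "t = (m + 1) ^ (2 * k)"
    let ?G = "{E \<in> graphs_on {1..n}. U_free k {1..n} E}"
    have n: "real n \<ge> 1" using elim by simp
    have ge1: "real n powr (2 * \<beta>) \<ge> 1" "real n powr (1 - \<beta>) \<ge> 1"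
      using n \<beta> by (auto intro!: ge_one_powr_ge_zero)
    have m: "real n powr (2 * \<beta>) \<le> real m" "real m \<le> real n powr (2 * \<beta>) + 1"
      using ge1 unfolding m_def by linarith+
    have s: "real n powr (1 - \<beta>) \<le> real s" "real s \<le> real n powr (1 - \<beta>) + 1"
      using ge1 unfolding s_def by linarith+
    have "2 * real n * ln (real n) < real n powr (1 - \<beta>) * real n powr (2 * \<beta>)"
      using elim n by (simp add: powr_add[symmetric] add.commute)
    also have "\<dots> \<le> real s * real m" using m s by (intro mult_mono) auto
    finally have "card ?G \<le> t ^ n * (2 ^ n) ^ t * ((n + 1) ^ s) ^ n"
      unfolding t_def using elim by (intro card_U_free_le) auto
    \<comment> \<open>Charging \<open>t\<close> bits per index makes the indices as costly as the
      centres, whence \<open>2 * n * t\<close> in total.\<close>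
    also have "\<dots> \<le> (2 ^ t) ^ n * (2 ^ n) ^ t * ((n + 1) ^ s) ^ n"
      using less_exp[of t] by (intro mult_right_mono power_mono) auto
    finally have "real (card ?G) \<le> real ((2 ^ t) ^ n * (2 ^ n) ^ t * ((n + 1) ^ s) ^ n)"
      by (rule of_nat_mono)
    also have "\<dots> = 2 powr (2 * real n * real t + real s * real n * log 2 (real n + 1))"
    proof -
      have "real ((2 ^ t) ^ n * (2 ^ n) ^ t) = 2 powr (2 * real n * real t)"
      proof -
        have "((2::real) ^ t) ^ n * (2 ^ n) ^ t = 2 ^ (2 * n * t)"
          by (simp add: power_mult[symmetric] power_add[symmetric] algebra_simps)
        then show ?thesis by (simp add: powr_realpow[symmetric])
      qed
      moreover have "real (((n + 1) ^ s) ^ n) = 2 powr (real s * real n * log 2 (real n + 1))"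
      proof -
        have "real (((n + 1) ^ s) ^ n) = (real n + 1) powr (real s * real n)"
          by (simp add: power_mult[symmetric] powr_realpow[symmetric] add.commute)
        also have "\<dots> = (2 powr log 2 (real n + 1)) powr (real s * real n)" by simp
        also have "\<dots> = 2 powr (real s * real n * log 2 (real n + 1))"
          by (simp only: powr_powr mult.commute)
        finally show ?thesis .
      qed
      ultimately show ?thesis by (simp add: powr_add)
    qed
    also have "\<dots> \<le> 2 powr (real n powr (2 - \<beta> / 2))"
    proof (intro powr_mono)
      \<comment> \<open>The \<open>3\<close>: rounding up gives
        \<open>m + 1 \<le> n powr (2 * \<beta>) + 2\<close>, and the power is at least
        \<open>1\<close>.\<close>
      have "real t \<le> (3 * real n powr (2 * \<beta>)) ^ (2 * k)"
        unfolding t_def of_nat_power using m ge1 by (intro power_mono) auto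
      also have "\<dots> = 9 ^ k * real n powr (\<beta> * (4 * real k))"
      proof -
        have "(real n powr (2 * \<beta>)) ^ (2 * k) = real n powr (\<beta> * (4 * real k))"
          using n by (simp add: powr_realpow[symmetric] powr_powr algebra_simps)
        moreover have "(3::real) ^ (2 * k) = 9 ^ k" by (simp add: power_mult)
        ultimately show ?thesis by (simp add: power_mult_distrib)
      qed
      also have "\<dots> \<le> 9 ^ k * real n powr (1/2)"
        using n \<beta> by (intro mult_left_mono powr_mono) auto
      finally have "2 * real n * real t \<le> 2 * real n * (9 ^ k * real n powr (1/2))"
        by (intro mult_left_mono) auto
      moreover have "real s * real n * log 2 (real n + 1)
          \<le> (2 * real n powr (1 - \<beta>)) * real n * log 2 (real n + 1)"
        using s ge1 n by (intro mult_right_mono) auto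
      ultimately show "2 * real n * real t + real s * real n * log 2 (real n + 1)
          \<le> real n powr (2 - \<beta> / 2)"
        using elim by linarith
    qed simp
    finally show ?case .
  qed
qed

theorem theorem2:
  fixes k :: nat
  shows "\<exists>\<epsilon>::real. \<epsilon> > 0 \<and>
           (\<forall>n::nat. real (card {E \<in> graphs_on {1..n}. U_free k {1..n} E})
                       \<le> 2 powr (real n powr (2 - \<epsilon>)))"
proof -
  define \<beta> where "\<beta> = 1 / (8 * (real k + 1))"
  have \<beta>: "\<beta> > 0" by (simp add: \<beta>_def)
  obtain n0 where n0: "\<And>n. n \<ge> n0 \<Longrightarrow> real (card {E \<in> graphs_on {1..n}. U_free k {1..n} E})
                       \<le> 2 powr (real n powr (2 - \<beta> / 2))"
    using eventually_card_U_free_le[of k] unfolding \<beta>_def eventually_sequentially by blast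
  \<comment> \<open>Solves \<open>(n0 + 2) powr \<delta> = 2\<close>; the shift by \<open>2\<close>
    keeps the logarithm positive even for \<open>n0 = 0\<close>.\<close>
  define \<delta> where "\<delta> = 1 / log 2 (real n0 + 2)"
  have log: "log 2 (real n0 + 2) > 0" by simp
  then have \<delta>: "\<delta> > 0" by (simp add: \<delta>_def)
  define \<epsilon> where "\<epsilon> = min (\<beta> / 2) \<delta>"
  have bound: "real (card {E \<in> graphs_on {1..n}. U_free k {1..n} E}) \<le> 2 powr (real n powr (2 - \<epsilon>))"
    for n
  proof (cases "n = 0")
    case True
    \<comment> \<open>As \<open>0 powr x = 0\<close>, both the trivial and the claimed bound equal
      \<open>2 powr 0 = 1\<close>.\<close>
    then show ?thesis using card_graphs_le[of n "U_free k {1..n}"] by simp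
  next
    case False
    then have n: "real n \<ge> 1" by simp
    show ?thesis
    proof (cases "n \<ge> n0")
      case True
      have "2 powr (real n powr (2 - \<beta> / 2)) \<le> (2::real) powr (real n powr (2 - \<epsilon>))"
        using n by (intro powr_mono) (auto simp: \<epsilon>_def)
      then show ?thesis using n0[OF True] by linarith
    next
      case small: False
      \<comment> \<open>Here \<open>real n powr \<delta> \<le> 2\<close>, so the bound is weaker than \<open>2 ^ (n choose 2)\<close>.\<close>
      have "real n powr \<delta> \<le> (real n0 + 2) powr \<delta>"
        using small \<delta> by (intro powr_mono2) auto
      also have "\<dots> = (2 powr log 2 (real n0 + 2)) powr \<delta>" by simp
      also have "\<dots> = 2" using log unfolding powr_powr \<delta>_def by (metis less_irrefl mult.right_neutral nonzero_mult_div_cancel_left powr_one times_divide_eq_right zero_le_numeral)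
      finally have "real n ^ 2 / 2 \<le> real n ^ 2 / real n powr \<delta>"
        using n by (intro divide_left_mono) auto
      also have "\<dots> = real n powr (2 - \<delta>)" using n by (simp add: powr_diff)
      also have "\<dots> \<le> real n powr (2 - \<epsilon>)"
        using n by (intro powr_mono) (auto simp: \<epsilon>_def)
      finally have "2 powr (real n ^ 2 / 2) \<le> (2::real) powr (real n powr (2 - \<epsilon>))"
        by (intro powr_mono) auto
      then show ?thesis using card_graphs_le[of n "U_free k {1..n}"] by linarith
    qed
  qed
  have "\<epsilon> > 0" using \<beta> \<delta> by (simp add: \<epsilon>_def)
  with bound show ?thesis by blast
qed

end
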